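(* Let $r_H>0$, $\beta>0$ and $\tau_H=\ln r_H$. Let $(A,B)$ be the local solution, real analytic near $\tau=\tau_H$, of the system $$A B'' + \tfrac15\Big[B'\big(24e^{-2B}-4e^{-12B}\big)-6\big(e^{-2B}-e^{-12B}\big)\Big]=0,$$ $$A'=-4A\big(1+B'^2\big)+\tfrac15\big(24e^{-2B}-4e^{-12B}\big)$$ (primes denote $d/d\tau$) satisfying $A(\tau_H)=0$ and $B(\tau_H)=\beta$. Then this solution extends to a solution on all of $[\tau_H,\infty)$, and for all $\tau>\tau_H$ it satisfies $$0<B'(\tau)<\tfrac14,\qquad 0<A(\tau)<1,\qquad B(\tau)>0 .$$
   Context: With $\tau=\ln r$, the system consists of the static vacuum Einstein equations in $6+1$ dimensions for the metric ansatz $ds^2=-Ae^{-2\delta}dt^2+A^{-1}dr^2+r^2(e^{-8B}\sigma^2+e^{2B}d\Sigma_2^2)$ on squashed 5-spheres; the remaining equation $\delta'=-4B'^2$ decouples. For each $r_H>0$, $\beta>0$ there is a unique solution $(A,B)$ of the system, real analytic in a neighbourhood of $\tau_H$, with $A(\tau_H)=0$, $B(\tau_H)=\beta$; as a function of $r$ it behaves as $$B(r)= \beta+\frac{6}{4}\,\frac{e^{-2\beta}-e^{-12\beta}}{6e^{-2\beta}-e^{-12\beta}}\Big(\frac{r}{r_H}-1\Big)+O\big((r-r_H)^2\big),$$ $$A(r)=\frac45\big(6e^{-2\beta}-e^{-12\beta}\big)\Big(\frac{r}{r_H}-1\Big)+O\big((r-r_H)^2\big).$$ The resulting global solution is called a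 warped black hole. *)

theory Defs
  imports "HOL-Analysis.Analysis"
begin

definition real_analytic_on :: "(real \<Rightarrow> real) \<Rightarrow> real set \<Rightarrow> bool" where
  "real_analytic_on f S \<longleftrightarrow> (\<forall>x\<in>S. \<exists>F. (\<lambda>h. f (x + h)) has_fps_expansion F)"

(* Derivatives are two-sided. If S is not open, the functions must therefore be given on a
   neighbourhood of S. *)
definition warped_solution_on :: "real set \<Rightarrow> (real \<Rightarrow> real) \<Rightarrow> (real \<Rightarrow> real) \<Rightarrow> bool" where
  "warped_solution_on S A B \<longleftrightarrow>
     (\<forall>\<tau>\<in>S.
        A differentiable (at \<tau>) \<and> B differentiable (at \<tau>) \<and> deriv B differentiable (at \<tau>) \<and>
        A \<tau> * deriv (deriv B) \<tau>
          + 1/5 * (deriv B \<tau> * (24 * exp (- 2 * B \<tau>) - 4 * exp (- 12 * B \<tau>))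
                   - 6 * (exp (- 2 * B \<tau>) - exp (- 12 * B \<tau>))) = 0 \<and>
        deriv A \<tau> = - 4 * A \<tau> * (1 + (deriv B \<tau>)\<^sup>2)
          + 1/5 * (24 * exp (- 2 * B \<tau>) - 4 * exp (- 12 * B \<tau>)))"

end

(* Write P = B', F = drive B, G = force B, so that A P' = G - P F and A' = F - 4 A (1 + P^2).
   At the horizon A = 0 forces P = G / F, which lies in (0, 1/4) because G - F / 4 = - exp (- 12 B).
   The same identity makes 1/4 a barrier for P; the other bounds are barriers as well:
   A' = F > 0 where A = 0, A' < 0 where A = 1 (as F <= 4), and A P' = G > 0 where P = 0.
   Hence all inequalities persist as long as the solution exists. They give
   A' >= - 5 A, so A stays above an explicit decaying exponential c. Clamping A to [c, 1], P to
   [0, 1/4] and B to [0, oo) makes the first-order system Lipschitz on each bounded time interval;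
   its global solution never leaves the clamping region, so it solves the original system. *)
theory Submission
  imports Defs
begin

section \<open>Barriers\<close>

text \<open>The infimum \<open>s\<close> of the failure times either equals \<open>a\<close> or
  satisfies \<open>Q s\<close> by \<open>limit\<close>; then \<open>start\<close> or
  \<open>right\<close> carries \<open>Q\<close> past \<open>s\<close>, a contradiction. Nothing is
  claimed at \<open>a\<close>, because \<open>A > 0\<close> fails at the horizon itself.\<close>

lemma continuous_induction:
  fixes a b t :: real
  assumes start: "eventually Q (at_right a)"
    and limit: "\<And>s. a < s \<Longrightarrow> s < b \<Longrightarrow> (\<And>t. a < t \<Longrightarrow> t < s \<Longrightarrow> Q t) \<Longrightarrow> Q s"
    and right: "\<And>s. a < s \<Longrightarrow> s < b \<Longrightarrow> Q s \<Longrightarrow> eventually Q (at_right s)"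
    and t: "a < t" "t < b"
  shows "Q t"
proof (rule ccontr)
  assume "\<not> Q t"
  define S where "S = {t. a < t \<and> t < b \<and> \<not> Q t}"
  define s where "s = Inf S"
  have tS: "t \<in> S" using t \<open>\<not> Q t\<close> by (simp add: S_def)
  have bdd: "bdd_below S" by (rule bdd_belowI[of _ a]) (auto simp: S_def)
  have "s \<le> t" unfolding s_def using tS bdd by (rule cInf_lower)
  then have "s < b" using t by simp
  have "a \<le> s" unfolding s_def using tS by (intro cInf_greatest) (auto simp: S_def)
  have below: "Q r" if "a < r" "r < s" for r
    using cInf_lower[OF _ bdd, of r] that \<open>s < b\<close> by (force simp: S_def s_def)
  have Qs: "Q s" if "a < s" using limit[OF that \<open>s < b\<close>] below by blast
  have "eventually Q (at_right s)"
    using start right Qs \<open>s < b\<close> \<open>a \<le> s\<close> by (cases "a = s") auto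
  then obtain d where d: "d > s" "\<And>r. s < r \<Longrightarrow> r < d \<Longrightarrow> Q r"
    by (auto simp: eventually_at_right_field)
  have "d \<le> s" unfolding s_def
  proof (rule cInf_greatest)
    fix r assume "r \<in> S"
    then have r: "a < r" "\<not> Q r" by (auto simp: S_def)
    with below d(2) Qs show "d \<le> r" by (metis linorder_not_less order.order_iff_strict)
  qed (use tS in auto)
  with d show False by simp
qed

text \<open>If \<open>u b < 0\<close>, let \<open>s\<close> be the last time with
  \<open>u s >= 0\<close>. Between \<open>s\<close> and \<open>b\<close> the function is negative,
  so \<open>u' >= 0\<close> there and the mean value theorem gives \<open>u b >= u s\<close>. A sign
  condition only where \<open>u < 0\<close> suits clamped fields, whose sign is known once a clamp
  is active.\<close>

lemma nonneg_of_deriv_nonneg_where_neg: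
  fixes u u' :: "real \<Rightarrow> real"
  assumes "a \<le> b" and "u a \<ge> 0"
    and deriv: "\<And>t. t \<in> {a..b} \<Longrightarrow> (u has_real_derivative u' t) (at t within {a..b})"
    and pos: "\<And>t. t \<in> {a..b} \<Longrightarrow> u t < 0 \<Longrightarrow> u' t \<ge> 0"
  shows "u b \<ge> 0"
proof (rule ccontr)
  assume "\<not> u b \<ge> 0"
  define K where "K = {a..b} \<inter> u -` {0..}"
  have cont: "continuous_on {a..b} u"
    by (rule DERIV_continuous_on[OF deriv])
  have "compact K"
    unfolding K_def
    by (metis Int_absorb1 closed_Int closed_atLeast closed_atLeastAtMost cont
        compact_Int_closed compact_Icc continuous_on_closed_vimage inf_commute inf_le2
        compact_eq_bounded_closed bounded_subset)
  moreover have "a \<in> K" using assms by (simp add: K_def)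
  ultimately obtain s where s: "s \<in> K" "\<And>t. t \<in> K \<Longrightarrow> t \<le> s"
    by (metis compact_attains_sup empty_iff)
  have "a \<le> s" "s < b" using s(1) \<open>\<not> u b \<ge> 0\<close> by (auto simp: K_def order.order_iff_strict)
  have "\<exists>z\<in>{s<..<b}. u b - u s = u' z * (b - s)"
    using \<open>a \<le> s\<close>
    by (intro mvt_simple[OF \<open>s < b\<close>])
       (auto intro!: has_derivative_subset[OF deriv[unfolded has_field_derivative_def]])
  then obtain z where z: "s < z" "z < b" "u b - u s = u' z * (b - s)" by auto
  have "u z < 0" using s(2)[of z] z \<open>a \<le> s\<close> by (force simp: K_def)
  then have "u' z \<ge> 0" using pos z \<open>a \<le> s\<close> by auto
  then have "u b \<ge> u s" using z by (smt (verit) mult_nonneg_nonneg)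
  with s(1) \<open>\<not> u b \<ge> 0\<close> show False by (auto simp: K_def)
qed

section \<open>Lipschitz ordinary differential equations\<close>

text \<open>Gronwall in energy form: the squared distance weighted by
  \<open>exp (- 2 * L * t)\<close> is nonincreasing, by Cauchy-Schwarz and the Lipschitz bound, and
  starts at 0. The inner product makes the squared distance differentiable.\<close>

lemma lipschitz_ode_unique:
  fixes x y :: "real \<Rightarrow> 'a::real_inner"
  assumes "a \<le> b" and "x a = y a"
    and x: "\<And>t. t \<in> {a..b} \<Longrightarrow> (x has_vector_derivative f t (x t)) (at t within {a..b})"
    and y: "\<And>t. t \<in> {a..b} \<Longrightarrow> (y has_vector_derivative f t (y t)) (at t within {a..b})"
    and lip: "\<And>t. t \<in> {a..b} \<Longrightarrow> L-lipschitz_on UNIV (f t)"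
  shows "x b = y b"
proof -
  define v where "v t = x t - y t" for t
  define v' where "v' t = f t (x t) - f t (y t)" for t
  \<comment> \<open>The minus sign lets the barrier lemma bound the weighted squared distance above
    by 0.\<close>
  define u where "u t = - (exp (- 2 * L * t) * (v t \<bullet> v t))" for t
  define u' where "u' t = exp (- 2 * L * t) * (2 * (L * (v t \<bullet> v t) - v t \<bullet> v' t))" for t
  have "u b \<ge> 0"
  proof (rule nonneg_of_deriv_nonneg_where_neg[OF \<open>a \<le> b\<close>])
    show "u a \<ge> 0" using assms by (simp add: u_def v_def)
  next
    fix t assume t: "t \<in> {a..b}"
    have "(v has_vector_derivative v' t) (at t within {a..b})"
      unfolding v_def v'_def using x[OF t] y[OF t] by (rule has_vector_derivative_diff)
    then have v: "(v has_derivative (\<lambda>h. h *\<^sub>R v' t)) (at t within {a..b})"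
      by (simp add: has_vector_derivative_def)
    show "(u has_real_derivative u' t) (at t within {a..b})"
      unfolding u_def u'_def has_field_derivative_def
      by (rule derivative_eq_intros v refl | simp)+
         (auto simp: fun_eq_iff algebra_simps inner_commute)
    have "norm (v' t) \<le> L * norm (v t)"
      using lipschitz_onD[OF lip[OF t], of "x t" "y t"] by (simp add: v_def v'_def dist_norm)
    then have "v t \<bullet> v' t \<le> norm (v t) * (L * norm (v t))"
      by (meson norm_cauchy_schwarz order_trans mult_left_mono norm_ge_zero)
    also have "\<dots> = L * (v t \<bullet> v t)" by (simp add: dot_square_norm power2_eq_square)
    finally show "u' t \<ge> 0" by (simp add: u'_def)
  qed
  then have "v b = 0"
    by (smt (verit, best) exp_gt_zero inner_gt_zero_iff mult_pos_pos u_def)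
  then show ?thesis by (simp add: v_def)
qed

text \<open>Picard iteration on the whole half-line. Since the Lipschitz bound is global in the
  state, the iterates converge uniformly on every \<open>{a..b}\<close>, with no smallness of the
  interval; the limit solves the integral equation, which is then differentiated.\<close>

lemma lipschitz_ode_exists:
  fixes f :: "real \<Rightarrow> 'a::banach \<Rightarrow> 'a"
  assumes cont: "continuous_on ({a..} \<times> UNIV) (\<lambda>(t, x). f t x)"
    and lip: "\<And>b. \<exists>L. \<forall>t\<in>{a..b}. L-lipschitz_on UNIV (f t)"
  shows "\<exists>x. x a = x0 \<and> (\<forall>t\<ge>a. (x has_vector_derivative f t (x t)) (at t within {a..}))"
proof -
  define X where "X = rec_nat (\<lambda>t. x0) (\<lambda>_ x t. x0 + integral {a..t} (\<lambda>s. f s (x s)))"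
  have X0: "X 0 = (\<lambda>t. x0)"
    and XS: "X (Suc n) t = x0 + integral {a..t} (\<lambda>s. f s (X n s))" for n t
    by (simp_all add: X_def)
  \<comment> \<open>Writing the limit as a telescoping series makes the Weierstrass test
    applicable.\<close>
  define x where "x t = x0 + (\<Sum>n. X (Suc n) t - X n t)" for t
  have cont_f: "continuous_on S (\<lambda>s. f s (y s))" if "continuous_on S y" "S \<subseteq> {a..}" for y S
  proof -
    have "continuous_on S (\<lambda>s. (\<lambda>(t, x). f t x) (s, y s))"
      by (rule continuous_on_compose2[OF cont]) (use that in \<open>auto intro!: continuous_intros\<close>)
    then show ?thesis by simp
  qed
  have cont_X: "continuous_on {a..b} (X n)" for n b
  proof (induction n)
    case (Suc n)
    have "(\<lambda>s. f s (X n s)) integrable_on {a..b}"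
      by (rule integrable_continuous_real) (rule cont_f[OF Suc], auto)
    then show ?case
      unfolding XS[abs_def] by (intro continuous_intros indefinite_integral_continuous_1)
  qed (simp add: X0)
  have unif: "uniform_limit {a..b} X x sequentially" for b
  proof -
    obtain L where "\<forall>t\<in>{a..b}. L-lipschitz_on UNIV (f t)" using lip by blast
    then have L: "norm (f t y - f t z) \<le> L * norm (y - z)" if "t \<in> {a..b}" for t y z
      using that lipschitz_onD[of L UNIV "f t" y z] by (auto simp: dist_norm)
    \<comment> \<open>For \<open>b < a\<close> the interval is empty and \<open>L\<close> may have
      any sign; \<open>K\<close> is positive in every case.\<close>
    define K where "K = \<bar>L\<bar> + 1"
    have K: "norm (f t y - f t z) \<le> K * norm (y - z)" if "t \<in> {a..b}" for t y z
      using L[OF that] by (smt (verit) K_def mult_right_mono norm_ge_zero)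
    have "K > 0" by (simp add: K_def)
    have "continuous_on {a..b} (\<lambda>t. X 1 t - X 0 t)"
      by (intro continuous_intros cont_X)
    then have "bounded ((\<lambda>t. X 1 t - X 0 t) ` {a..b})"
      by (intro compact_imp_bounded compact_continuous_image) auto
    then obtain C where "C > 0" and C: "\<And>t. t \<in> {a..b} \<Longrightarrow> norm (X 1 t - X 0 t) \<le> C"
      unfolding bounded_pos by auto
    \<comment> \<open>With the weight \<open>exp (2 * K * (t - a))\<close>, integrating \<open>K\<close> times the bound gains a factor \<open>1/2\<close>.\<close>
    have step: "norm (X (Suc n) t - X n t) \<le> C * (1/2)^n * exp (2 * K * (t - a))"
      if "t \<in> {a..b}" for n t
      using that
    proof (induction n arbitrary: t)
      case 0
      have "C * 1 \<le> C * exp (2 * K * (t - a))"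
        using 0 \<open>C > 0\<close> \<open>K > 0\<close> by (intro mult_left_mono) auto
      then show ?case using C[OF 0] by simp
    next
      case (Suc n)
      let ?g = "\<lambda>s. C * (1/2)^Suc n * exp (2 * K * (s - a))"
      let ?g' = "\<lambda>s. K * (C * (1/2)^n * exp (2 * K * (s - a)))"
      have int: "(\<lambda>s. f s (X m s)) integrable_on {a..t}" for m
        by (rule integrable_continuous_real) (rule cont_f[OF cont_X], auto)
      have g: "(?g' has_integral ?g t - ?g a) {a..t}"
        using Suc.prems
        by (intro fundamental_theorem_of_calculus)
           (auto intro!: derivative_eq_intros simp: has_real_derivative_iff_has_vector_derivative[symmetric])
      have "norm (X (Suc (Suc n)) t - X (Suc n) t) =
          norm (integral {a..t} (\<lambda>s. f s (X (Suc n) s) - f s (X n s)))"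
        unfolding XS[of "Suc n"] XS[of n t]
        by (subst Henstock_Kurzweil_Integration.integral_diff[OF int int]) simp
      also have "\<dots> \<le> integral {a..t} ?g'"
      proof (rule integral_norm_bound_integral)
        fix s assume s: "s \<in> {a..t}"
        then have sb: "s \<in> {a..b}" using Suc.prems by auto
        have "norm (f s (X (Suc n) s) - f s (X n s)) \<le> K * norm (X (Suc n) s - X n s)"
          by (rule K[OF sb])
        also have "\<dots> \<le> ?g' s"
          using Suc.IH[OF sb] \<open>K > 0\<close> by (intro mult_left_mono) auto
        finally show "norm (f s (X (Suc n) s) - f s (X n s)) \<le> ?g' s" .
      qed (use g in \<open>auto intro!: integrable_diff int\<close>)
      also have "\<dots> = ?g t - ?g a" using g by (rule integral_unique)
      also have "\<dots> \<le> ?g t" using \<open>C > 0\<close> by simp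
      finally show ?case .
    qed
    have "uniform_limit {a..b} (\<lambda>n t. \<Sum>i<n. X (Suc i) t - X i t)
        (\<lambda>t. \<Sum>i. X (Suc i) t - X i t) sequentially"
    proof (rule Weierstrass_m_test)
      show "norm (X (Suc n) t - X n t) \<le> C * (1/2)^n * exp (2 * K * (b - a))"
        if "t \<in> {a..b}" for n t
        using step[OF that, of n] that \<open>C > 0\<close> \<open>K > 0\<close>
        by (elim order_trans) (intro mult_left_mono, auto)
      show "summable (\<lambda>n. C * (1/2)^n * exp (2 * K * (b - a)))"
        by (intro summable_mult summable_mult2 summable_geometric) simp
    qed
    then have "uniform_limit {a..b} (\<lambda>n t. x0 + (\<Sum>i<n. X (Suc i) t - X i t)) x sequentially"
      unfolding x_def[abs_def] by (intro uniform_limit_intros)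
    moreover have "x0 + (\<Sum>i<n. X (Suc i) t - X i t) = X n t" for n t
      using sum_lessThan_telescope[of "\<lambda>i. X i t" n] by (simp add: X0)
    ultimately show ?thesis by simp
  qed
  have cont_x: "continuous_on {a..b} x" for b
    by (rule uniform_limit_theorem[OF _ unif]) (auto simp: cont_X)
  have fix_x: "x t = x0 + integral {a..t} (\<lambda>s. f s (x s))" if "t \<ge> a" for t
  proof -
    obtain L where L: "\<forall>s\<in>{a..t}. L-lipschitz_on UNIV (f s)" using lip by blast
    have "uniform_limit {a..t} (\<lambda>n s. f s (X n s)) (\<lambda>s. f s (x s)) sequentially"
    proof (rule uniform_limitI)
      fix e :: real assume "e > 0"
      then have "\<forall>\<^sub>F n in sequentially. \<forall>s\<in>{a..t}. dist (X n s) (x s) < e / (\<bar>L\<bar> + 1)"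
        using unif by (auto intro: uniform_limitD)
      then show "\<forall>\<^sub>F n in sequentially. \<forall>s\<in>{a..t}. dist (f s (X n s)) (f s (x s)) < e"
      proof eventually_elim
        case (elim n)
        show ?case
        proof
          fix s assume s: "s \<in> {a..t}"
          have "dist (f s (X n s)) (f s (x s)) \<le> L * dist (X n s) (x s)"
            using lipschitz_onD[of L UNIV "f s" "X n s" "x s"] L s by auto
          also have "\<dots> \<le> (\<bar>L\<bar> + 1) * dist (X n s) (x s)"
            by (intro mult_right_mono) auto
          also have "\<dots> < e" using elim s by (auto simp: field_simps)
          finally show "dist (f s (X n s)) (f s (x s)) < e" .
        qed
      qed
    qed
    then obtain I J where I: "\<And>n. ((\<lambda>s. f s (X n s)) has_integral I n) {a..t}"
        and J: "((\<lambda>s. f s (x s)) has_integral J) {a..t}" and IJ: "(I \<longlongrightarrow> J) sequentially"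
      using cont_f[OF cont_X] by (rule uniform_limit_integral) auto
    have "(\<lambda>n. X (Suc n) t) \<longlonglongrightarrow> x0 + J"
      unfolding XS using tendsto_add[OF tendsto_const IJ] integral_unique[OF I] by simp
    moreover have "(\<lambda>n. X (Suc n) t) \<longlonglongrightarrow> x t"
      by (rule LIMSEQ_Suc) (use tendsto_uniform_limitI[OF unif[of t], of t] that in simp)
    ultimately show ?thesis using integral_unique[OF J] LIMSEQ_unique by metis
  qed
  have "(x has_vector_derivative f t (x t)) (at t within {a..})" if "t \<ge> a" for t
  proof -
    \<comment> \<open>Going up to \<open>t + 1\<close> keeps \<open>t\<close> off the right end, so
      that the derivative within this interval is the derivative within
      \<open>{a..}\<close>.\<close>
    have cont: "continuous_on {a..t+1} (\<lambda>s. f s (x s))"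
      by (rule cont_f[OF cont_x]) auto
    have "((\<lambda>t. x0 + integral {a..t} (\<lambda>s. f s (x s))) has_vector_derivative f t (x t))
        (at t within {a..t+1})"
      using integral_has_vector_derivative[OF cont, of t] that by (auto intro!: derivative_eq_intros)
    then have "(x has_vector_derivative f t (x t)) (at t within {a..t+1})"
      by (rule has_vector_derivative_transform[rotated 2]) (use that fix_x in auto)
    moreover have "at t within {a..t+1} = at t within {a..}"
      by (rule at_within_nhd[of _ "{..<t+1}"]) auto
    ultimately show ?thesis by simp
  qed
  moreover have "x a = x0" using fix_x[of a] by simp
  ultimately show ?thesis by blast
qed

section \<open>Bounded Lipschitz functions and their algebra\<close>

text \<open>Boundedness is part of the notion because products of Lipschitz functions need not be
  Lipschitz without it. One constant \<open>M\<close>, uniform in time, serves both bounds.\<close>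

definition bdd_lipschitz :: "real set \<Rightarrow> (real \<Rightarrow> 'a::real_normed_vector \<Rightarrow> real) \<Rightarrow> bool" where
  "bdd_lipschitz S g \<longleftrightarrow>
     (\<exists>M. \<forall>t\<in>S. \<forall>x y. \<bar>g t x\<bar> \<le> M \<and> \<bar>g t x - g t y\<bar> \<le> M * norm (x - y))"

lemma bdd_lipschitzI:
  assumes "\<And>t x. t \<in> S \<Longrightarrow> \<bar>g t x\<bar> \<le> M"
    and "\<And>t x y. t \<in> S \<Longrightarrow> \<bar>g t x - g t y\<bar> \<le> L * norm (x - y)"
  shows "bdd_lipschitz S g"
  unfolding bdd_lipschitz_def
proof (intro exI ballI allI conjI)
  fix t x y assume t: "t \<in> S"
  show "\<bar>g t x\<bar> \<le> max M L" using assms(1)[OF t, of x] by simp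
  show "\<bar>g t x - g t y\<bar> \<le> max M L * norm (x - y)"
    using assms(2)[OF t, of x y] by (rule order_trans) (simp add: mult_right_mono)
qed

lemma bdd_lipschitzE:
  assumes "bdd_lipschitz S g"
  obtains M where "M \<ge> 0" "\<And>t x. t \<in> S \<Longrightarrow> \<bar>g t x\<bar> \<le> M"
    "\<And>t x y. t \<in> S \<Longrightarrow> \<bar>g t x - g t y\<bar> \<le> M * norm (x - y)"
proof -
  obtain M where M: "\<forall>t\<in>S. \<forall>x y. \<bar>g t x\<bar> \<le> M \<and> \<bar>g t x - g t y\<bar> \<le> M * norm (x - y)"
    using assms by (auto simp: bdd_lipschitz_def)
  show ?thesis
  proof (rule that[of "max 0 M"])
    fix t x y assume t: "t \<in> S"
    show "\<bar>g t x\<bar> \<le> max 0 M" using M t by (metis max.coboundedI2)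
    have "\<bar>g t x - g t y\<bar> \<le> M * norm (x - y)" using M t by blast
    then show "\<bar>g t x - g t y\<bar> \<le> max 0 M * norm (x - y)"
      by (rule order_trans) (simp add: mult_right_mono)
  qed simp
qed

lemma bdd_lipschitz_const: "bdd_lipschitz S (\<lambda>t x. c)"
  by (rule bdd_lipschitzI[of _ _ "\<bar>c\<bar>" 0]) auto

lemma bdd_lipschitz_add:
  assumes "bdd_lipschitz S g" "bdd_lipschitz S h"
  shows "bdd_lipschitz S (\<lambda>t x. g t x + h t x)"
proof -
  obtain M where M: "M \<ge> 0" "\<And>t x. t \<in> S \<Longrightarrow> \<bar>g t x\<bar> \<le> M"
    "\<And>t x y. t \<in> S \<Longrightarrow> \<bar>g t x - g t y\<bar> \<le> M * norm (x - y)"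
    using assms(1) by (rule bdd_lipschitzE) blast
  obtain N where N: "N \<ge> 0" "\<And>t x. t \<in> S \<Longrightarrow> \<bar>h t x\<bar> \<le> N"
    "\<And>t x y. t \<in> S \<Longrightarrow> \<bar>h t x - h t y\<bar> \<le> N * norm (x - y)"
    using assms(2) by (rule bdd_lipschitzE) blast
  show ?thesis
  proof (rule bdd_lipschitzI)
    fix t x y assume t: "t \<in> S"
    show "\<bar>g t x + h t x\<bar> \<le> M + N" using M(2)[OF t, of x] N(2)[OF t, of x] by linarith
    show "\<bar>g t x + h t x - (g t y + h t y)\<bar> \<le> (M + N) * norm (x - y)"
      using M(3)[OF t, of x y] N(3)[OF t, of x y] unfolding distrib_right by linarith
  qed
qed

lemma bdd_lipschitz_mult:
  assumes "bdd_lipschitz S g" "bdd_lipschitz S h"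
  shows "bdd_lipschitz S (\<lambda>t x. g t x * h t x)"
proof -
  obtain M where M: "M \<ge> 0" "\<And>t x. t \<in> S \<Longrightarrow> \<bar>g t x\<bar> \<le> M"
    "\<And>t x y. t \<in> S \<Longrightarrow> \<bar>g t x - g t y\<bar> \<le> M * norm (x - y)"
    using assms(1) by (rule bdd_lipschitzE) blast
  obtain N where N: "N \<ge> 0" "\<And>t x. t \<in> S \<Longrightarrow> \<bar>h t x\<bar> \<le> N"
    "\<And>t x y. t \<in> S \<Longrightarrow> \<bar>h t x - h t y\<bar> \<le> N * norm (x - y)"
    using assms(2) by (rule bdd_lipschitzE) blast
  show ?thesis
  proof (rule bdd_lipschitzI)
    fix t x y assume t: "t \<in> S"
    show "\<bar>g t x * h t x\<bar> \<le> M * N"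
      unfolding abs_mult by (intro mult_mono M N t) auto
    have "g t x * h t x - g t y * h t y = g t x * (h t x - h t y) + (g t x - g t y) * h t y"
      by (simp add: algebra_simps)
    also have "\<bar>\<dots>\<bar> \<le> \<bar>g t x\<bar> * \<bar>h t x - h t y\<bar> + \<bar>g t x - g t y\<bar> * \<bar>h t y\<bar>"
      by (metis abs_mult abs_triangle_ineq)
    also have "\<dots> \<le> M * (N * norm (x - y)) + (M * norm (x - y)) * N"
      by (intro add_mono mult_mono M N t) (auto simp: M N)
    also have "\<dots> = (2 * M * N) * norm (x - y)" by simp
    finally show "\<bar>g t x * h t x - g t y * h t y\<bar> \<le> (2 * M * N) * norm (x - y)" .
  qed
qed

lemma bdd_lipschitz_cmult: "bdd_lipschitz S g \<Longrightarrow> bdd_lipschitz S (\<lambda>t x. c * g t x)"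
  by (intro bdd_lipschitz_mult bdd_lipschitz_const)

lemma bdd_lipschitz_diff:
  assumes "bdd_lipschitz S g" "bdd_lipschitz S h"
  shows "bdd_lipschitz S (\<lambda>t x. g t x - h t x)"
  using bdd_lipschitz_add[OF assms(1) bdd_lipschitz_cmult[OF assms(2), of "-1"]] by simp

text \<open>The difference of the inverses is the difference of the values over their product, and
  both denominators are at least \<open>m\<close>.\<close>

lemma bdd_lipschitz_inverse:
  assumes "bdd_lipschitz S g" and "m > 0" and m: "\<And>t x. t \<in> S \<Longrightarrow> g t x \<ge> m"
  shows "bdd_lipschitz S (\<lambda>t x. inverse (g t x))"
proof -
  obtain M where M: "M \<ge> 0" "\<And>t x. t \<in> S \<Longrightarrow> \<bar>g t x\<bar> \<le> M"
    "\<And>t x y. t \<in> S \<Longrightarrow> \<bar>g t x - g t y\<bar> \<le> M * norm (x - y)"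
    using assms(1) by (rule bdd_lipschitzE) blast
  show ?thesis
  proof (rule bdd_lipschitzI)
    have inv: "\<bar>inverse (g t x)\<bar> \<le> inverse m" if "t \<in> S" for t x
      using m[OF that, of x] \<open>m > 0\<close> by (simp add: le_imp_inverse_le)
    show "\<bar>inverse (g t x)\<bar> \<le> inverse m" if "t \<in> S" for t x using inv[OF that] .
    fix t x y assume t: "t \<in> S"
    have "inverse (g t x) - inverse (g t y) = inverse (g t x) * (g t y - g t x) * inverse (g t y)"
      using m[OF t, of x] m[OF t, of y] \<open>m > 0\<close> by (simp add: field_simps)
    also have "\<bar>\<dots>\<bar> \<le> inverse m * (M * norm (x - y)) * inverse m"
      unfolding abs_mult using M(3)[OF t, of y x] inv[OF t] M(1) \<open>m > 0\<close>
      by (intro mult_mono) (auto simp: norm_minus_commute)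
    also have "\<dots> = (inverse m * M * inverse m) * norm (x - y)" by simp
    finally show "\<bar>inverse (g t x) - inverse (g t y)\<bar> \<le> (inverse m * M * inverse m) * norm (x - y)" .
  qed
qed

text \<open>Truncation does not increase distances. The lower end may vary with time, since two
  states are compared only at the same time; \<open>lo t >= 0\<close> makes \<open>hi\<close> a
  bound for the absolute value.\<close>

lemma bdd_lipschitz_clamp:
  fixes l :: "'a::real_normed_vector \<Rightarrow> real"
  assumes l: "\<And>x y. \<bar>l x - l y\<bar> \<le> norm (x - y)" and "\<And>t. t \<in> S \<Longrightarrow> lo t \<ge> 0"
    and "\<And>t. t \<in> S \<Longrightarrow> lo t \<le> hi"
  shows "bdd_lipschitz S (\<lambda>t x. max (lo t) (min hi (l x)))"
proof (rule bdd_lipschitzI[of _ _ hi 1])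
  fix t x y assume "t \<in> S"
  with assms(2,3)[of t] l[of x y]
  show "\<bar>max (lo t) (min hi (l x))\<bar> \<le> hi"
    "\<bar>max (lo t) (min hi (l x)) - max (lo t) (min hi (l y))\<bar> \<le> 1 * norm (x - y)"
    by (auto simp: max_def min_def)
qed

text \<open>The clamp keeps the exponent nonpositive, where \<open>exp\<close> is bounded by 1 and
  has slope at most 1.\<close>

lemma bdd_lipschitz_exp:
  fixes l :: "'a::real_normed_vector \<Rightarrow> real"
  assumes l: "\<And>x y. \<bar>l x - l y\<bar> \<le> norm (x - y)" and "k \<ge> 0"
  shows "bdd_lipschitz S (\<lambda>t x. exp (- k * max 0 (l x)))"
proof (rule bdd_lipschitzI[of _ _ 1 k])
  have *: "\<bar>exp (- u) - exp (- v)\<bar> \<le> \<bar>u - v\<bar>" if "0 \<le> u" "0 \<le> v" for u v :: real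
    using that
  proof (induction u v rule: linorder_wlog)
    case (le u v)
    have "exp (- u) - exp (- v) = exp (- u) * (1 - exp (u - v))"
      by (simp add: algebra_simps flip: exp_add)
    also have "\<dots> \<le> 1 * (v - u)"
    proof (intro mult_mono)
      show "1 - exp (u - v) \<le> v - u"
        using exp_ge_add_one_self[of "u - v"] by linarith
    qed (use le in auto)
    finally show ?case using le by simp
  qed (simp add: abs_minus_commute)
  fix x y :: 'a
  have "\<bar>exp (- (k * max 0 (l x))) - exp (- (k * max 0 (l y)))\<bar>
      \<le> \<bar>k * max 0 (l x) - k * max 0 (l y)\<bar>"
    using \<open>k \<ge> 0\<close> by (intro *) auto
  also have "\<dots> = k * \<bar>max 0 (l x) - max 0 (l y)\<bar>"
    using \<open>k \<ge> 0\<close> by (simp add: abs_mult flip: right_diff_distrib)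
  also have "\<dots> \<le> k * norm (x - y)"
    using \<open>k \<ge> 0\<close> l[of x y] by (intro mult_left_mono) auto
  finally show "\<bar>exp (- k * max 0 (l x)) - exp (- k * max 0 (l y))\<bar> \<le> k * norm (x - y)"
    by simp
qed (use \<open>k \<ge> 0\<close> in auto)

lemma lipschitz_on_triple:
  assumes "bdd_lipschitz S g1" "bdd_lipschitz S g2" "bdd_lipschitz S g3"
  shows "\<exists>L. \<forall>t\<in>S. L-lipschitz_on UNIV (\<lambda>x. (g1 t x, g2 t x, g3 t x))"
proof -
  obtain M1 where M1: "M1 \<ge> 0" "\<And>t x. t \<in> S \<Longrightarrow> \<bar>g1 t x\<bar> \<le> M1"
    "\<And>t x y. t \<in> S \<Longrightarrow> \<bar>g1 t x - g1 t y\<bar> \<le> M1 * norm (x - y)"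
    using assms(1) by (rule bdd_lipschitzE) blast
  obtain M2 where M2: "M2 \<ge> 0" "\<And>t x. t \<in> S \<Longrightarrow> \<bar>g2 t x\<bar> \<le> M2"
    "\<And>t x y. t \<in> S \<Longrightarrow> \<bar>g2 t x - g2 t y\<bar> \<le> M2 * norm (x - y)"
    using assms(2) by (rule bdd_lipschitzE) blast
  obtain M3 where M3: "M3 \<ge> 0" "\<And>t x. t \<in> S \<Longrightarrow> \<bar>g3 t x\<bar> \<le> M3"
    "\<And>t x y. t \<in> S \<Longrightarrow> \<bar>g3 t x - g3 t y\<bar> \<le> M3 * norm (x - y)"
    using assms(3) by (rule bdd_lipschitzE) blast
  have norm3: "norm (a, b, c) \<le> \<bar>a\<bar> + \<bar>b\<bar> + \<bar>c\<bar>" for a b c :: real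
    using norm_Pair_le[of a "(b, c)"] norm_Pair_le[of b c] by simp
  have "(M1 + M2 + M3)-lipschitz_on UNIV (\<lambda>x. (g1 t x, g2 t x, g3 t x))" if t: "t \<in> S" for t
  proof (rule lipschitz_onI)
    fix x y
    show "dist (g1 t x, g2 t x, g3 t x) (g1 t y, g2 t y, g3 t y) \<le> (M1 + M2 + M3) * dist x y"
      using norm3[of "g1 t x - g1 t y" "g2 t x - g2 t y" "g3 t x - g3 t y"]
        M1(3)[OF t, of x y] M2(3)[OF t, of x y] M3(3)[OF t, of x y]
      unfolding dist_norm distrib_right by simp
  qed (use M1(1) M2(1) M3(1) in simp)
  then show ?thesis by blast
qed

section \<open>Bounds beyond the horizon\<close>

definition drive :: "real \<Rightarrow> real" where
  "drive b = 1/5 * (24 * exp (- 2 * b) - 4 * exp (- 12 * b))"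

definition force :: "real \<Rightarrow> real" where
  "force b = 6/5 * (exp (- 2 * b) - exp (- 12 * b))"

lemma drive_pos:
  assumes "b \<ge> 0"
  shows "drive b > 0"
proof -
  have "exp (- 12 * b) \<le> exp (- 2 * b)" using assms by simp
  moreover have "0 < exp (- 2 * b)" by simp
  ultimately have "0 < 24 * exp (- 2 * b) - 4 * exp (- 12 * b)" by argo
  then show ?thesis by (simp add: drive_def)
qed

text \<open>With \<open>y = exp (- 2 * b)\<close> the claim is
  \<open>1 + 6 * (y - 1) <= y ^ 6\<close>: the graph of the sixth power lies above its tangent at
  1.\<close>

lemma drive_le: "drive b \<le> 4"
proof -
  have "1 + real 6 * (exp (- 2 * b) - 1) \<le> (1 + (exp (- 2 * b) - 1)) ^ 6"
    by (rule Bernoulli_inequality) simp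
  also have "\<dots> = exp (- 12 * b)" by (simp flip: exp_of_nat_mult)
  finally show ?thesis by (simp add: drive_def)
qed

lemma force_nonneg: "b \<ge> 0 \<Longrightarrow> force b \<ge> 0"
  and force_pos: "b > 0 \<Longrightarrow> force b > 0"
  by (simp_all add: force_def)

text \<open>\<open>1/4\<close> is the ratio of the coefficients of \<open>exp (- 2 * b)\<close> in
  \<open>force\<close> and \<open>drive\<close>, so this term cancels and only a negative remainder
  is left. This is the source of the bound \<open>1/4\<close> on \<open>B'\<close>.\<close>

lemma force_eq: "force b = drive b / 4 - exp (- 12 * b)"
  by (simp add: force_def drive_def field_simps)

text \<open>Here \<open>P'\<close> is a number: the derivative of the function \<open>P\<close> at \<open>t\<close>.\<close>

definition warped_at :: "real \<Rightarrow> (real \<Rightarrow> real) \<Rightarrow> (real \<Rightarrow> real) \<Rightarrow> (real \<Rightarrow> real) \<Rightarrow> real \<Rightarrow> bool" where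
  "warped_at t A B P P' \<longleftrightarrow>
    (A has_real_derivative drive (B t) - 4 * A t * (1 + (P t)\<^sup>2)) (at t) \<and>
    (B has_real_derivative P t) (at t) \<and> (P has_real_derivative P') (at t) \<and>
    A t * P' = force (B t) - P t * drive (B t)"

section \<open>Passage between the second-order system and its pointwise first-order form\<close>

lemma warped_solution_on_iff:
  "warped_solution_on S A B \<longleftrightarrow> (\<forall>t\<in>S. warped_at t A B (deriv B) (deriv (deriv B) t))"
  unfolding warped_solution_on_def
proof (intro ball_cong refl)
  fix t
  have deriv_iff: "(f has_real_derivative D) (at t) \<longleftrightarrow> f differentiable at t \<and> deriv f t = D"
    for f :: "real \<Rightarrow> real" and D
    by (metis DERIV_deriv_iff_real_differentiable DERIV_imp_deriv real_differentiable_def)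
  have second: "a * q + 1/5 * (p * (24 * exp (- 2 * b) - 4 * exp (- 12 * b))
      - 6 * (exp (- 2 * b) - exp (- 12 * b))) = 0 \<longleftrightarrow> a * q = force b - p * drive b"
    for a b p q
    unfolding force_def drive_def by argo
  have first: "- 4 * a * r + 1/5 * (24 * exp (- 2 * b) - 4 * exp (- 12 * b)) = drive b - 4 * a * r"
    for a b r
    unfolding drive_def by simp
  show "(A differentiable (at t) \<and> B differentiable (at t) \<and> deriv B differentiable (at t) \<and>
      A t * deriv (deriv B) t
        + 1/5 * (deriv B t * (24 * exp (- 2 * B t) - 4 * exp (- 12 * B t))
                 - 6 * (exp (- 2 * B t) - exp (- 12 * B t))) = 0 \<and>
      deriv A t = - 4 * A t * (1 + (deriv B t)\<^sup>2)
        + 1/5 * (24 * exp (- 2 * B t) - 4 * exp (- 12 * B t))) \<longleftrightarrow>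
    warped_at t A B (deriv B) (deriv (deriv B) t)"
    unfolding warped_at_def deriv_iff first second by blast
qed

text \<open>Openness is what makes \<open>P\<close> agree with \<open>deriv B\<close> near each
  point, so that the derivative of \<open>P\<close> is also that of \<open>deriv B\<close>.\<close>

lemma warped_solution_onI:
  assumes "open S" and sol: "\<And>t. t \<in> S \<Longrightarrow> warped_at t A B P (P' t)"
  shows "warped_solution_on S A B"
  unfolding warped_solution_on_iff
proof
  have P: "deriv B t = P t" if "t \<in> S" for t
    using sol[OF that] by (auto simp: warped_at_def intro: DERIV_imp_deriv)
  fix t assume t: "t \<in> S"
  have "(P has_real_derivative P' t) (at t)" using sol[OF t] by (simp add: warped_at_def)
  then have "(deriv B has_real_derivative P' t) (at t)"
    by (rule has_field_derivative_transform_within_open[OF _ \<open>open S\<close> t]) (simp add: P)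
  then show "warped_at t A B (deriv B) (deriv (deriv B) t)"
    using sol[OF t] P[OF t] DERIV_imp_deriv by (fastforce simp: warped_at_def)
qed

text \<open>Being a solution on an open set is a local property; this is what permits
  gluing.\<close>

lemma warped_solution_on_cong:
  assumes "open S" and eq: "\<And>t. t \<in> S \<Longrightarrow> A' t = A t \<and> B' t = B t"
    and sol: "warped_solution_on S A B"
  shows "warped_solution_on S A' B'"
proof (rule warped_solution_onI[OF \<open>open S\<close>])
  fix t assume t: "t \<in> S"
  have *: "(f' has_real_derivative D) (at t)"
    if "(f has_real_derivative D) (at t)" "\<And>t. t \<in> S \<Longrightarrow> f' t = f t" for f f' :: "real \<Rightarrow> real" and D
    using that(1) by (rule has_field_derivative_transform_within_open[OF _ \<open>open S\<close> t]) (simp add: that)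
  have "warped_at t A B (deriv B) (deriv (deriv B) t)"
    using sol t by (auto simp: warped_solution_on_iff)
  then show "warped_at t A' B' (deriv B) (deriv (deriv B) t)"
    using eq eq[OF t] by (auto simp: warped_at_def intro: *)
qed

section \<open>Strict barriers and their propagation from the horizon\<close>

text \<open>Continuity gives \<open>f s >= 0\<close>. If \<open>f s = 0\<close>, then
  \<open>D > 0\<close> would make \<open>f\<close> negative just to the left of \<open>s\<close>.
  This supplies the limit step of the continuous induction.\<close>

lemma pos_at_right_endpoint:
  fixes f :: "real \<Rightarrow> real"
  assumes "(f has_real_derivative D) (at s)" and "a < s"
    and pos: "\<And>t. a < t \<Longrightarrow> t < s \<Longrightarrow> f t > 0"
    and D: "f s = 0 \<Longrightarrow> D > 0"
  shows "f s > 0"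
proof (rule ccontr)
  assume neg: "\<not> f s > 0"
  have "(f \<longlongrightarrow> f s) (at_left s)"
    using DERIV_isCont[OF assms(1)] by (simp add: isCont_def filterlim_at_split)
  moreover have "eventually (\<lambda>t. 0 \<le> f t) (at_left s)"
    using eventually_at_left_real[OF \<open>a < s\<close>] by eventually_elim (auto intro: less_imp_le pos)
  ultimately have "f s \<ge> 0" by (rule tendsto_lowerbound) simp
  then have "f s = 0" using neg by simp
  then obtain d where d: "d > 0" "\<And>h. 0 < h \<Longrightarrow> h < d \<Longrightarrow> f (s - h) < 0"
    using DERIV_pos_inc_left[OF assms(1) D] by auto
  define h where "h = min (d / 2) ((s - a) / 2)"
  have "0 < h" "h < d" "a < s - h" using d(1) \<open>a < s\<close> by (auto simp: h_def min_def field_simps)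
  then show False using d(2)[of h] pos[of "s - h"] by simp
qed

text \<open>The bounds are bundled because the barrier arguments rely on one another.\<close>

definition admissible :: "real \<Rightarrow> real \<Rightarrow> real \<Rightarrow> bool" where
  "admissible A B P \<longleftrightarrow> 0 < P \<and> P < 1/4 \<and> 0 < A \<and> A < 1 \<and> B > 0"

text \<open>Continuous induction from the horizon: the equations at \<open>a\<close> start all
  bounds, continuity extends them to the right, and the barriers preserve their strictness in the
  limit.\<close>

lemma admissible_after_horizon:
  assumes sol: "\<And>t. a \<le> t \<Longrightarrow> t < b \<Longrightarrow> warped_at t A B P (P' t)"
    and "A a = 0" "B a > 0" and t: "a < t" "t < b"
  shows "admissible (A t) (B t) (P t)"
  using _ _ _ t
proof (rule continuous_induction)
  have lim: "(A \<longlongrightarrow> A s) (at_right s)" "(B \<longlongrightarrow> B s) (at_right s)" "(P \<longlongrightarrow> P s) (at_right s)"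
    if "a \<le> s" "s < b" for s
    using sol[OF that]
    by (auto simp: warped_at_def isCont_def filterlim_at_split dest!: DERIV_isCont)
  have "a < b" using t by simp
  note hor = sol[OF order_refl \<open>a < b\<close>, unfolded warped_at_def]
  have dr: "drive (B a) > 0" using \<open>B a > 0\<close> by (simp add: drive_pos)
  have Pa: "P a * drive (B a) = force (B a)" using hor \<open>A a = 0\<close> by simp
  have "0 < P a" using Pa force_pos[OF \<open>B a > 0\<close>] dr by (metis zero_less_mult_pos2)
  have "force (B a) < 1/4 * drive (B a)" by (simp add: force_eq)
  then have "P a < 1/4" unfolding Pa[symmetric] using dr by simp
  \<comment> \<open>Of the five bounds only \<open>A > 0\<close> fails at \<open>a\<close>, so it
    needs a positive derivative; the others are strict at \<open>a\<close> and persist by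
    continuity.\<close>
  have "(A has_real_derivative drive (B a)) (at a)" using hor \<open>A a = 0\<close> by simp
  from DERIV_pos_inc_right[OF this dr]
  obtain d where d: "d > 0" "\<And>h. 0 < h \<Longrightarrow> h < d \<Longrightarrow> A (a + h) > 0"
    using \<open>A a = 0\<close> by auto
  have "A t > 0" if "a < t" "t < a + d" for t using d(2)[of "t - a"] that by simp
  then have "eventually (\<lambda>t. A t > 0) (at_right a)"
    unfolding eventually_at_right_field using \<open>d > 0\<close> by (metis less_add_same_cancel1)
  moreover have "eventually (\<lambda>t. A t < 1) (at_right a)"
    using order_tendstoD(2)[OF lim(1)[OF order_refl \<open>a < b\<close>]] \<open>A a = 0\<close> by simp
  moreover note order_tendstoD(1)[OF lim(2)[OF order_refl \<open>a < b\<close>] \<open>B a > 0\<close>]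
    order_tendstoD(1)[OF lim(3)[OF order_refl \<open>a < b\<close>] \<open>P a > 0\<close>]
    order_tendstoD(2)[OF lim(3)[OF order_refl \<open>a < b\<close>] \<open>P a < 1/4\<close>]
  ultimately show "\<forall>\<^sub>F t in at_right a. admissible (A t) (B t) (P t)"
    unfolding admissible_def by eventually_elim auto

  show "\<forall>\<^sub>F t in at_right s. admissible (A t) (B t) (P t)"
    if s: "a < s" "s < b" "admissible (A s) (B s) (P s)" for s
  proof -
    have "a \<le> s" using s by simp
    note lim = lim[OF this \<open>s < b\<close>]
    show ?thesis
      using s(3) order_tendstoD[OF lim(1)] order_tendstoD(1)[OF lim(2)] order_tendstoD[OF lim(3)]
      unfolding admissible_def by (intro eventually_conj) blast+
  qed

  fix s assume s: "a < s" "s < b"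
    and adm: "\<And>t. a < t \<Longrightarrow> t < s \<Longrightarrow> admissible (A t) (B t) (P t)"
  have ats: "(A has_real_derivative drive (B s) - 4 * A s * (1 + (P s)\<^sup>2)) (at s)"
    "(P has_real_derivative P' s) (at s)" "A s * P' s = force (B s) - P s * drive (B s)"
    using sol[of s] s by (auto simp: warped_at_def)
  \<comment> \<open>A limit of positive values need not be positive; monotonicity, from
    \<open>P > 0\<close> before \<open>s\<close>, keeps \<open>B s\<close> above \<open>B a\<close>.
    The order of the remaining bounds matters: \<open>A > 0\<close> uses \<open>B\<close>, both
    bounds on \<open>P\<close> use \<open>A\<close>, and \<open>A < 1\<close> uses
    \<open>P > 0\<close>.\<close>
  have "B a < B s"
  proof (rule DERIV_pos_imp_increasing_open[OF \<open>a < s\<close>])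
    fix t assume "a < t" "t < s"
    then show "\<exists>y. (B has_real_derivative y) (at t) \<and> 0 < y"
      using sol[of t] adm[of t] s by (auto simp: warped_at_def admissible_def)
  next
    show "continuous_on {a..s} B"
    proof (rule continuous_at_imp_continuous_on, rule ballI)
      fix t assume "t \<in> {a..s}"
      then show "isCont B t" using sol[of t] s by (auto simp: warped_at_def intro: DERIV_isCont)
    qed
  qed
  then have B: "B s > 0" using \<open>B a > 0\<close> by simp
  have A: "A s > 0"
    using ats(1) \<open>a < s\<close> by (rule pos_at_right_endpoint) (use adm drive_pos B in \<open>auto simp: admissible_def\<close>)
  have P: "P s > 0"
    using ats(2) \<open>a < s\<close>
  proof (rule pos_at_right_endpoint)
    assume "P s = 0"
    then have "A s * P' s > 0" using ats(3) force_pos[OF B] by simp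
    then show "P' s > 0" using A by (simp add: zero_less_mult_iff)
  qed (use adm in \<open>auto simp: admissible_def\<close>)
  have "((\<lambda>t. 1/4 - P t) has_real_derivative - P' s) (at s)"
    using ats(2) by (auto intro!: derivative_eq_intros)
  then have P4: "1/4 - P s > 0"
    using \<open>a < s\<close>
  proof (rule pos_at_right_endpoint)
    assume "1/4 - P s = 0"
    then have "P s = 1/4" by simp
    then have "A s * P' s = force (B s) - 1/4 * drive (B s)" using ats(3) by (simp only:)
    then have "A s * P' s < 0" by (simp add: force_eq)
    then show "- P' s > 0" using A by (simp add: mult_less_0_iff)
  qed (use adm in \<open>auto simp: admissible_def\<close>)
  have "((\<lambda>t. 1 - A t) has_real_derivative 4 * A s * (1 + (P s)\<^sup>2) - drive (B s)) (at s)"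
    using ats(1) by (auto intro!: derivative_eq_intros)
  then have "1 - A s > 0"
    using \<open>a < s\<close>
  proof (rule pos_at_right_endpoint)
    assume "1 - A s = 0"
    then have "A s = 1" by simp
    then have "4 * A s * (1 + (P s)\<^sup>2) = 4 + 4 * (P s)\<^sup>2" by simp
    \<comment> \<open>Since \<open>drive\<close> is only known to be at most 4, strictness at
      \<open>A s = 1\<close> comes from this square.\<close>
    moreover have "(P s)\<^sup>2 > 0" using P by simp
    ultimately show "4 * A s * (1 + (P s)\<^sup>2) - drive (B s) > 0"
      using drive_le[of "B s"] by linarith
  qed (use adm in \<open>auto simp: admissible_def\<close>)
  with A B P P4 show "admissible (A s) (B s) (P s)" by (simp add: admissible_def)
qed

section \<open>Global continuation\<close>

text \<open>The state is the triple $(A, B, B')$.\<close>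

definition clamped_field ::
  "(real \<Rightarrow> real) \<Rightarrow> real \<Rightarrow> real \<times> real \<times> real \<Rightarrow> real \<times> real \<times> real" where
  "clamped_field c t x =
    (let a = max (c t) (min 1 (fst x)); b = max 0 (fst (snd x)); p = max 0 (min (1/4) (snd (snd x)))
     in (drive b - 4 * (a * (1 + p * p)), p, (force b - p * drive b) * inverse a))"

text \<open>Where no clamp acts, the field is the original system solved for \<open>P'\<close>. This
  serves both directions: the given solution solves the clamped equation, and the global clamped
  solution solves the original one.\<close>

lemma clamped_field_eq:
  assumes "c t \<le> A" "A \<le> 1" "0 \<le> B" "0 \<le> P" "P \<le> 1/4"
  shows "clamped_field c t (A, B, P) =
    (drive B - 4 * A * (1 + P\<^sup>2), P, (force B - P * drive B) / A)"
proof -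
  have clamps: "max (c t) (min 1 A) = A" "max 0 B = B" "max 0 (min (1/4) P) = P"
    using assms by auto
  show ?thesis
    unfolding clamped_field_def Let_def fst_conv snd_conv clamps
    by (simp add: power2_eq_square divide_inverse)
qed

lemma continuous_on_clamped_field:
  assumes "continuous_on S c" "\<And>t. t \<in> S \<Longrightarrow> c t > 0"
  shows "continuous_on (S \<times> UNIV) (\<lambda>(t, x). clamped_field c t x)"
proof -
  have "max (c t) (min 1 u) \<noteq> 0" if "t \<in> S" for t u
    using assms(2)[OF that] by (auto simp: max_def)
  then show ?thesis
    unfolding clamped_field_def Let_def case_prod_beta drive_def force_def
    by (intro continuous_intros continuous_on_compose2[OF assms(1)]) auto
qed

text \<open>The uniform lower bound \<open>m\<close> controls the inverse of the clamped
  \<open>A\<close>. A decaying \<open>c\<close> has such a bound on bounded time intervals only, so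
  the Lipschitz constant depends on the interval.\<close>

lemma lipschitz_clamped_field:
  assumes "m > 0" and c: "\<And>t. t \<in> S \<Longrightarrow> m \<le> c t \<and> c t \<le> 1"
  shows "\<exists>L. \<forall>t\<in>S. L-lipschitz_on UNIV (clamped_field c t)"
proof -
  let ?B = "\<lambda>x :: real \<times> real \<times> real. fst (snd x)"
  have coord: "\<bar>fst x - fst y\<bar> \<le> norm (x - y)"
    "\<bar>?B x - ?B y\<bar> \<le> norm (x - y)" "\<bar>snd (snd x) - snd (snd y)\<bar> \<le> norm (x - y)"
    for x y :: "real \<times> real \<times> real"
    by (metis fst_diff snd_diff norm_fst_le norm_snd_le order_trans prod.collapse real_norm_def)+
  have A: "bdd_lipschitz S (\<lambda>t x :: real \<times> real \<times> real. max (c t) (min 1 (fst x)))"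
    by (intro bdd_lipschitz_clamp coord) (use c \<open>m > 0\<close> in force)+
  have P: "bdd_lipschitz S (\<lambda>t x :: real \<times> real \<times> real. max 0 (min (1/4) (snd (snd x))))"
    by (intro bdd_lipschitz_clamp coord) auto
  have E: "bdd_lipschitz S (\<lambda>t x. exp (- k * max 0 (?B x)))" if "k \<ge> 0" for k
    using coord(2) that by (rule bdd_lipschitz_exp)
  have D: "bdd_lipschitz S (\<lambda>t x. drive (max 0 (?B x)))"
    unfolding drive_def by (intro bdd_lipschitz_cmult bdd_lipschitz_diff E) auto
  have F: "bdd_lipschitz S (\<lambda>t x. force (max 0 (?B x)))"
    unfolding force_def by (intro bdd_lipschitz_cmult bdd_lipschitz_diff E) auto
  have "bdd_lipschitz S (\<lambda>t x :: real \<times> real \<times> real. inverse (max (c t) (min 1 (fst x))))"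
    using A \<open>m > 0\<close> by (rule bdd_lipschitz_inverse) (use c in \<open>auto simp: le_max_iff_disj\<close>)
  then show ?thesis
    unfolding clamped_field_def Let_def
    by (intro lipschitz_on_triple bdd_lipschitz_mult bdd_lipschitz_diff bdd_lipschitz_cmult
      bdd_lipschitz_add bdd_lipschitz_const A P D F)
qed

section \<open>A priori bounds for the clamped flow\<close>

text \<open>The barrier argument for the difference of \<open>u\<close> and the exponential. It is
  used for the clamped solution and for the given one.\<close>

lemma ge_exp_decay:
  assumes "a \<le> s"
    and deriv: "\<And>t. t \<in> {a..s} \<Longrightarrow> (u has_real_derivative u' t) (at t within {a..s})"
    and ge: "\<And>t. t \<in> {a..s} \<Longrightarrow> u t < u a * exp (- k * (t - a)) \<Longrightarrow>
      u' t \<ge> - k * (u a * exp (- k * (t - a)))"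
  shows "u s \<ge> u a * exp (- k * (s - a))"
proof -
  have "u s - u a * exp (- k * (s - a)) \<ge> 0"
  proof (rule nonneg_of_deriv_nonneg_where_neg[OF \<open>a \<le> s\<close>])
    show "((\<lambda>t. u t - u a * exp (- k * (t - a))) has_real_derivative
        u' t + k * (u a * exp (- k * (t - a)))) (at t within {a..s})" if "t \<in> {a..s}" for t
      using deriv[OF that] by (auto intro!: derivative_eq_intros)
  qed (use ge in force)+
  then show ?thesis by simp
qed

text \<open>Once a coordinate crosses a face of the region, its clamp freezes it at the boundary
  value, and the field does not push it further out. Weak inequalities suffice for this.\<close>

lemma clamped_solution_bounds:
  fixes A B P c :: "real \<Rightarrow> real"
  assumes "a \<le> s" and bounds: "0 < A a" "A a \<le> 1" "0 \<le> B a" "0 \<le> P a" "P a \<le> 1/4"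
    and c: "\<And>t. c t = A a * exp (- 5 * (t - a))"
    and sol: "\<And>t. t \<in> {a..s} \<Longrightarrow>
      ((\<lambda>t. (A t, B t, P t)) has_vector_derivative clamped_field c t (A t, B t, P t))
        (at t within {a..s})"
  shows "c s \<le> A s" "A s \<le> 1" "0 \<le> B s" "0 \<le> P s" "P s \<le> 1/4"
proof -
  define C where "C t = clamped_field c t (A t, B t, P t)" for t
  have d: "(A has_real_derivative fst (C t)) (at t within {a..s})"
    "(B has_real_derivative fst (snd (C t))) (at t within {a..s})"
    "(P has_real_derivative snd (snd (C t))) (at t within {a..s})" if "t \<in> {a..s}" for t
  proof -
    note fst = bounded_linear.has_vector_derivative[OF bounded_linear_fst]
    note snd = bounded_linear.has_vector_derivative[OF bounded_linear_snd]
    note sol = sol[OF that, folded C_def]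
    show "(A has_real_derivative fst (C t)) (at t within {a..s})"
      "(B has_real_derivative fst (snd (C t))) (at t within {a..s})"
      "(P has_real_derivative snd (snd (C t))) (at t within {a..s})"
      using fst[OF sol] fst[OF snd[OF sol]] snd[OF snd[OF sol]]
      by (simp_all add: has_real_derivative_iff_has_vector_derivative)
  qed
  have c_le: "c t \<le> 1" "c t > 0" if "t \<in> {a..s}" for t
  proof -
    have "A a * exp (- 5 * (t - a)) \<le> 1 * 1"
      using bounds that by (intro mult_mono) auto
    then show "c t \<le> 1" "c t > 0" using bounds by (simp_all add: c)
  qed
  note C_eq = C_def clamped_field_def Let_def
  show "0 \<le> B s"
    using \<open>a \<le> s\<close> bounds(3) d(2)
    by (rule nonneg_of_deriv_nonneg_where_neg) (auto simp: C_eq)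
  show "0 \<le> P s"
    using \<open>a \<le> s\<close> bounds(4) d(3)
  proof (rule nonneg_of_deriv_nonneg_where_neg)
    fix t assume t: "t \<in> {a..s}" "P t < 0"
    have "max (c t) (min 1 (A t)) > 0" using c_le(2)[OF t(1)] by auto
    then show "0 \<le> snd (snd (C t))"
      using t(2) force_nonneg[of "max 0 (B t)"] by (simp add: C_eq)
  qed
  have "0 \<le> 1/4 - P s"
  proof (rule nonneg_of_deriv_nonneg_where_neg[OF \<open>a \<le> s\<close>])
    fix t assume t: "t \<in> {a..s}"
    show "((\<lambda>t. 1/4 - P t) has_real_derivative - snd (snd (C t))) (at t within {a..s})"
      using d(3)[OF t] by (auto intro!: derivative_eq_intros)
    assume "1/4 - P t < 0"
    \<comment> \<open>With the clamp at \<open>1/4\<close>, \<open>force_eq\<close> makes the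
      derivative of \<open>P\<close> negative.\<close>
    then have "max 0 (min (1/4) (P t)) = 1/4" by simp
    then have "snd (snd (C t)) = - exp (- 12 * max 0 (B t)) * inverse (max (c t) (min 1 (A t)))"
      by (simp add: C_eq force_eq)
    moreover have "max (c t) (min 1 (A t)) > 0" using c_le(2)[OF t] by auto
    ultimately show "0 \<le> - snd (snd (C t))" by simp
  qed (use bounds in simp)
  then show "P s \<le> 1/4" by simp
  show "c s \<le> A s"
    unfolding c
  proof (rule ge_exp_decay[OF \<open>a \<le> s\<close> d(1)])
    fix t assume t: "t \<in> {a..s}" "A t < A a * exp (- 5 * (t - a))"
    \<comment> \<open>The clamp gives \<open>1 + p * p <= 17/16 <= 5/4\<close>, and 4 times
      \<open>5/4\<close> is the decay rate 5 of \<open>c\<close>.\<close>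
    define p where "p = max 0 (min (1/4) (P t))"
    have "A t < c t" using t(2) by (simp add: c)
    then have "max (c t) (min 1 (A t)) = c t" by simp
    then have eq: "fst (C t) = drive (max 0 (B t)) - 4 * (c t * (1 + p * p))"
      by (simp add: C_eq p_def)
    have "p * p \<le> 1/4 * (1/4)" by (intro mult_mono) (auto simp: p_def)
    then have "c t * (1 + p * p) \<le> c t * (5/4)"
      using c_le(2)[OF t(1)] by (intro mult_left_mono) auto
    moreover have "drive (max 0 (B t)) > 0" by (simp add: drive_pos)
    ultimately show "- 5 * (A a * exp (- 5 * (t - a))) \<le> fst (C t)" unfolding eq c[symmetric] by linarith
  qed
  have "0 \<le> 1 - A s"
  proof (rule nonneg_of_deriv_nonneg_where_neg[OF \<open>a \<le> s\<close>])
    fix t assume t: "t \<in> {a..s}"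
    show "((\<lambda>t. 1 - A t) has_real_derivative - fst (C t)) (at t within {a..s})"
      using d(1)[OF t] by (auto intro!: derivative_eq_intros)
    assume "1 - A t < 0"
    \<comment> \<open>\<open>c t <= 1\<close> keeps the lower clamp from overriding the value 1;
      then \<open>drive <= 4\<close> settles the sign.\<close>
    then have "max (c t) (min 1 (A t)) = 1" using c_le(1)[OF t] by simp
    then obtain p where "fst (C t) = drive (max 0 (B t)) - 4 * (1 + p * p)"
      by (simp add: C_eq)
    then show "0 \<le> - fst (C t)"
      using drive_le[of "max 0 (B t)"] zero_le_square[of p] by argo
  qed (use bounds in simp)
  then show "A s \<le> 1" by simp
qed

text \<open>The clamped flow started at time \<open>a\<close> exists for all later times and stays
  in the region, while admissibility makes the given solution a clamped solution too; uniqueness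
  identifies them on \<open>[a, b)\<close>. The solution property is stated only after
  \<open>a\<close> because it needs two-sided derivatives.\<close>

lemma warped_continuation:
  fixes A B P P' :: "real \<Rightarrow> real"
  assumes "a < b"
    and sol: "\<And>t. a \<le> t \<Longrightarrow> t < b \<Longrightarrow> warped_at t A B P (P' t)"
    and adm: "\<And>t. a \<le> t \<Longrightarrow> t < b \<Longrightarrow> admissible (A t) (B t) (P t)"
  obtains A\<^sub>g B\<^sub>g where "\<And>t. a \<le> t \<Longrightarrow> t < b \<Longrightarrow> A\<^sub>g t = A t \<and> B\<^sub>g t = B t"
    and "warped_solution_on {a<..} A\<^sub>g B\<^sub>g"
proof -
  define c where "c t = A a * exp (- 5 * (t - a))" for t
  have "0 < A a" "A a \<le> 1" "0 \<le> B a" "0 \<le> P a" "P a \<le> 1/4"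
    using adm[of a] \<open>a < b\<close> by (simp_all add: admissible_def)
  note init = this
  have lip: "\<exists>L. \<forall>t\<in>{a..s}. L-lipschitz_on UNIV (clamped_field c t)" for s
  proof (rule lipschitz_clamped_field)
    show "c s > 0" using init by (simp add: c_def)
    fix t assume t: "t \<in> {a..s}"
    have "A a * exp (- 5 * (t - a)) \<le> 1 * 1"
      using init t by (intro mult_mono) auto
    then show "c s \<le> c t \<and> c t \<le> 1" using init t by (simp add: c_def)
  qed
  have "continuous_on ({a..} \<times> UNIV) (\<lambda>(t, x). clamped_field c t x)"
    using init by (intro continuous_on_clamped_field) (auto simp: c_def intro!: continuous_intros)
  from lipschitz_ode_exists[OF this lip] obtain x where xa: "x a = (A a, B a, P a)"
    and x: "\<And>t. a \<le> t \<Longrightarrow> (x has_vector_derivative clamped_field c t (x t)) (at t within {a..})"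
    by blast
  define A\<^sub>g where "A\<^sub>g t = fst (x t)" for t
  define B\<^sub>g where "B\<^sub>g t = fst (snd (x t))" for t
  define P\<^sub>g where "P\<^sub>g t = snd (snd (x t))" for t
  have x_eq: "x = (\<lambda>t. (A\<^sub>g t, B\<^sub>g t, P\<^sub>g t))" by (simp add: A\<^sub>g_def B\<^sub>g_def P\<^sub>g_def)
  have xg: "(x has_vector_derivative clamped_field c t (x t)) (at t within {a..s})"
    if "t \<in> {a..s}" for t s
    using x[of t] that by (auto intro: has_vector_derivative_within_subset)
  have init_g: "A\<^sub>g a = A a" "B\<^sub>g a = B a" "P\<^sub>g a = P a"
    using xa by (simp_all add: x_eq)
  have bounds: "c s \<le> A\<^sub>g s" "A\<^sub>g s \<le> 1" "0 \<le> B\<^sub>g s" "0 \<le> P\<^sub>g s" "P\<^sub>g s \<le> 1/4" if "a \<le> s" for s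
    using clamped_solution_bounds[OF that, of A\<^sub>g B\<^sub>g P\<^sub>g c] xg[of _ s] init
    by (simp_all add: init_g c_def x_eq)
  have "x s = (A s, B s, P s)" if s: "a \<le> s" "s < b" for s
  proof -
    obtain L where L: "\<And>t. t \<in> {a..s} \<Longrightarrow> L-lipschitz_on UNIV (clamped_field c t)"
      using lip by blast
    \<comment> \<open>Admissibility gives only \<open>A > 0\<close>; the lower clamp is inactive
      along the given solution because \<open>A' >= - 5 * A\<close>.\<close>
    have cA: "c t \<le> A t" if t: "t \<in> {a..s}" for t
      unfolding c_def
    proof (rule ge_exp_decay)
      show "a \<le> t" using t by simp
      fix r assume r: "r \<in> {a..t}"
      then have r': "a \<le> r" "r < b" using t s by auto
      show "(A has_real_derivative drive (B r) - 4 * A r * (1 + (P r)\<^sup>2)) (at r within {a..t})"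
        using sol[OF r'] by (auto simp: warped_at_def intro: has_field_derivative_at_within)
      note adm = adm[OF r', unfolded admissible_def]
      have "(P r)\<^sup>2 \<le> (1/4)\<^sup>2" using adm by (intro power_mono) auto
      then have "A r * (1 + (P r)\<^sup>2) \<le> A r * (5/4)"
        using adm by (intro mult_left_mono) (auto simp: power2_eq_square)
      moreover have "drive (B r) > 0" using adm by (simp add: drive_pos)
      moreover assume "A r < A a * exp (- 5 * (r - a))"
      ultimately show "- 5 * (A a * exp (- 5 * (r - a))) \<le> drive (B r) - 4 * A r * (1 + (P r)\<^sup>2)"
        by linarith
    qed
    have "((\<lambda>t. (A t, B t, P t)) has_vector_derivative clamped_field c t (A t, B t, P t))
        (at t within {a..s})" if t: "t \<in> {a..s}" for t
    proof -
      have t': "a \<le> t" "t < b" using t s by auto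
      note ad = adm[OF t', unfolded admissible_def]
      have "clamped_field c t (A t, B t, P t) =
          (drive (B t) - 4 * A t * (1 + (P t)\<^sup>2), P t, (force (B t) - P t * drive (B t)) / A t)"
        using ad cA[OF t] by (intro clamped_field_eq) auto
      moreover have "P' t = (force (B t) - P t * drive (B t)) / A t"
        using sol[OF t'] ad by (auto simp: warped_at_def field_simps)
      ultimately show ?thesis
        using sol[OF t'] unfolding warped_at_def has_real_derivative_iff_has_vector_derivative
        by (auto intro!: has_vector_derivative_Pair intro: has_vector_derivative_at_within)
    qed
    from lipschitz_ode_unique[OF s(1) _ xg this L] show ?thesis by (simp add: xa)
  qed
  then have "A\<^sub>g t = A t \<and> B\<^sub>g t = B t" if "a \<le> t" "t < b" for t
    using that by (simp add: A\<^sub>g_def B\<^sub>g_def)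
  moreover have "warped_solution_on {a<..} A\<^sub>g B\<^sub>g"
  proof (rule warped_solution_onI)
    fix t assume "t \<in> {a<..}"
    then have t: "a < t" "a \<le> t" by auto
    define Q where "Q = (force (B\<^sub>g t) - P\<^sub>g t * drive (B\<^sub>g t)) / A\<^sub>g t"
    \<comment> \<open>For \<open>t > a\<close> the one-sided derivative of the clamped solution is
      two-sided.\<close>
    have "at t within {a..} = at t"
      using t by (intro at_within_interior) (simp add: interior_Ici)
    then have x': "(x has_vector_derivative
        (drive (B\<^sub>g t) - 4 * A\<^sub>g t * (1 + (P\<^sub>g t)\<^sup>2), P\<^sub>g t, Q)) (at t)"
      using x[OF t(2)] bounds[OF t(2)] by (simp add: x_eq clamped_field_eq Q_def)
    note fst = bounded_linear.has_vector_derivative[OF bounded_linear_fst]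
    note snd = bounded_linear.has_vector_derivative[OF bounded_linear_snd]
    have "c t > 0" using init by (simp add: c_def)
    then have "A\<^sub>g t * Q = force (B\<^sub>g t) - P\<^sub>g t * drive (B\<^sub>g t)"
      using bounds(1)[OF t(2)] by (simp add: Q_def)
    then show "warped_at t A\<^sub>g B\<^sub>g P\<^sub>g ((force (B\<^sub>g t) - P\<^sub>g t * drive (B\<^sub>g t)) / A\<^sub>g t)"
      using fst[OF x'] fst[OF snd[OF x']] snd[OF snd[OF x']]
      unfolding Q_def[symmetric] warped_at_def has_real_derivative_iff_has_vector_derivative
      by (simp add: A\<^sub>g_def[abs_def] B\<^sub>g_def[abs_def] P\<^sub>g_def[abs_def])
  qed simp
  ultimately show ?thesis using that by blast
qed

section \<open>Gluing and the bounds for all times\<close>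

theorem mainTheorem1:
  fixes r\<^sub>H \<beta> \<tau>\<^sub>H \<epsilon> :: real and A B :: "real \<Rightarrow> real"
  assumes "r\<^sub>H > 0" and "\<beta> > 0" and "\<tau>\<^sub>H = ln r\<^sub>H"
    and "\<epsilon> > 0"
    and "real_analytic_on A {\<tau>\<^sub>H - \<epsilon><..<\<tau>\<^sub>H + \<epsilon>}"
    and "real_analytic_on B {\<tau>\<^sub>H - \<epsilon><..<\<tau>\<^sub>H + \<epsilon>}"
    and "warped_solution_on {\<tau>\<^sub>H - \<epsilon><..<\<tau>\<^sub>H + \<epsilon>} A B"
    and "A \<tau>\<^sub>H = 0" and "B \<tau>\<^sub>H = \<beta>"
  shows "\<exists>A\<^sub>g B\<^sub>g :: real \<Rightarrow> real.
           (\<forall>\<tau>\<in>{\<tau>\<^sub>H - \<epsilon><..<\<tau>\<^sub>H + \<epsilon>}. A\<^sub>g \<tau> = A \<tau> \<and> B\<^sub>g \<tau> = B \<tau>) \<and>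
           warped_solution_on {\<tau>\<^sub>H..} A\<^sub>g B\<^sub>g \<and>
           (\<forall>\<tau>>\<tau>\<^sub>H. 0 < deriv B\<^sub>g \<tau> \<and> deriv B\<^sub>g \<tau> < 1/4 \<and>
                    0 < A\<^sub>g \<tau> \<and> A\<^sub>g \<tau> < 1 \<and> B\<^sub>g \<tau> > 0)"
proof -
  define b where "b = \<tau>\<^sub>H + \<epsilon>"
  \<comment> \<open>The restart lies past the horizon, where \<open>A > 0\<close>, and before
    \<open>b\<close>, so that the two solutions overlap.\<close>
  define t\<^sub>0 where "t\<^sub>0 = \<tau>\<^sub>H + \<epsilon> / 2"
  have t0: "\<tau>\<^sub>H < t\<^sub>0" "t\<^sub>0 < b" using \<open>\<epsilon> > 0\<close> by (auto simp: b_def t\<^sub>0_def)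
  have sol: "warped_at t A B (deriv B) (deriv (deriv B) t)" if "\<tau>\<^sub>H \<le> t" "t < b" for t
    using assms(7) that \<open>\<epsilon> > 0\<close> by (auto simp: warped_solution_on_iff b_def)
  have adm: "admissible (A t) (B t) (deriv B t)" if "\<tau>\<^sub>H < t" "t < b" for t
    using sol assms(8) _ that by (rule admissible_after_horizon) (use assms in auto)
  obtain A\<^sub>1 B\<^sub>1 where eq: "\<And>t. t\<^sub>0 \<le> t \<Longrightarrow> t < b \<Longrightarrow> A\<^sub>1 t = A t \<and> B\<^sub>1 t = B t"
    and sol1: "warped_solution_on {t\<^sub>0<..} A\<^sub>1 B\<^sub>1"
    by (rule warped_continuation[OF t0(2), of A B "deriv B" "deriv (deriv B)"])
       (use sol adm t0(1) in auto)
  \<comment> \<open>Switching at \<open>b\<close> keeps the given solution on both sides of the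
    horizon, where a two-sided derivative is needed.\<close>
  define A\<^sub>g where "A\<^sub>g t = (if t < b then A t else A\<^sub>1 t)" for t
  define B\<^sub>g where "B\<^sub>g t = (if t < b then B t else B\<^sub>1 t)" for t
  \<comment> \<open>Two overlapping open sets cover the half-line, and on each of them the glued
    pair coincides with a known solution.\<close>
  have "warped_solution_on {\<tau>\<^sub>H - \<epsilon><..<b} A\<^sub>g B\<^sub>g"
    by (rule warped_solution_on_cong[OF _ _ assms(7)[folded b_def]]) (auto simp: A\<^sub>g_def B\<^sub>g_def)
  moreover have "warped_solution_on {t\<^sub>0<..} A\<^sub>g B\<^sub>g"
    by (rule warped_solution_on_cong[OF _ _ sol1]) (use eq in \<open>auto simp: A\<^sub>g_def B\<^sub>g_def\<close>)
  moreover have "{\<tau>\<^sub>H..} \<subseteq> {\<tau>\<^sub>H - \<epsilon><..<b} \<union> {t\<^sub>0<..}"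
    using t0 \<open>\<epsilon> > 0\<close> by auto
  ultimately have sol_g: "warped_solution_on {\<tau>\<^sub>H..} A\<^sub>g B\<^sub>g"
    unfolding warped_solution_on_iff by blast
  have "\<tau>\<^sub>H < b" using t0 by simp
  \<comment> \<open>The clamped bounds are only weak, so the barrier argument is run again for the
    glued solution from the horizon; ending at \<open>t + 1\<close> puts \<open>t\<close> inside the
    interval.\<close>
  have "admissible (A\<^sub>g t) (B\<^sub>g t) (deriv B\<^sub>g t)" if "\<tau>\<^sub>H < t" for t
  proof (rule admissible_after_horizon[of \<tau>\<^sub>H "t + 1" A\<^sub>g B\<^sub>g "deriv B\<^sub>g" "deriv (deriv B\<^sub>g)"])
    show "A\<^sub>g \<tau>\<^sub>H = 0" "0 < B\<^sub>g \<tau>\<^sub>H" using \<open>\<tau>\<^sub>H < b\<close> assms by (simp_all add: A\<^sub>g_def B\<^sub>g_def)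
  qed (use sol_g that in \<open>auto simp: warped_solution_on_iff\<close>)
  moreover have "\<forall>\<tau>\<in>{\<tau>\<^sub>H - \<epsilon><..<\<tau>\<^sub>H + \<epsilon>}. A\<^sub>g \<tau> = A \<tau> \<and> B\<^sub>g \<tau> = B \<tau>"
    by (simp add: A\<^sub>g_def B\<^sub>g_def b_def)
  ultimately show ?thesis
    using sol_g unfolding admissible_def by blast
qed

end
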